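(* Apply the general continued fraction algorithm (defined in the context) to a number $z\in\mathbb{C}$. If $z\in\mathbb{R}$, the algorithm produces the usual (standard) continued fraction expansion of $z$. If $z\notin\mathbb{R}$, the algorithm always terminates, with output $(a_0,a_1,\dots,a_r,z_0)$, and $$z=\langle a_0,a_1,\dots,a_{r-1},a_r+z_0\rangle,$$ where $a_0\in\mathbb{Z}$, $a_i\in\mathbb{Z}_{\ge 1}$ for $1\le i\le r$, and $z_0\in\mathcal{F}'\setminus\{0\}$.
   Context: For numbers $a_0,\dots,a_r$ write $\langle a_0,a_1,\dots,a_r\rangle:=a_0+\cfrac{1}{a_1+\cfrac{1}{\ddots+\cfrac{1}{a_r}}}$. The usual continued fraction algorithm for $x\in\mathbb{R}$: starting with $i=0$, let $m=\lfloor x\rfloor$, set $a_i=m$; if $x-m=0$ stop, otherwise replace $x$ by $1/(x-m)$, increment $i$ and repeat; the output $(a_0,a_1,\dots)$ gives $x=\langle a_0,a_1,\dots\rangle$. Let $\mathbb{H}$ be the upper half plane, $S=\begin{pmatrix}0&-1\\1&0\end{pmatrix}$ acting by $Sz=-1/z$, and $\mathcal{F}:=\{z=x+iy\in\mathbb{H}: -1/2\le x<1/2,\ |z|\ge 1,\ \text{and } |z|=1\Rightarrow x\le 0\}$. Put $\mathcal{F}':=\mathcal{F}\cup S\mathcal{F}\cup\{0\}\cup-(\mathcal{F}\cup S\mathcal{F})$. General continued fraction algorithm: for $z\in\mathbb{C}$, start with index $i=0$. Let $m=\lfloor \mathrm{Re}(z)\rfloor$. If $z-m-\delta\in\mathcal{F}'$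 for $\delta=0$ or $1$, then set $a_i=m+\delta$, $z_0=z-m-\delta$ and finish. Otherwise put $a_i=m$, replace $z$ by $1/(z-m)$, increment $i$ and repeat. The output is $(a_0,a_1,\dots)$ if $z\in\mathbb{R}$ initially, or $(a_0,a_1,\dots,a_r,z_0)$ if $z\notin\mathbb{R}$. *)

theory Defs
  imports Complex_Main "HOL-Library.Stream"
begin

(* The equation for the empty list is a dummy value. *)
fun cfrac :: "'a::field list \<Rightarrow> 'a" where
  "cfrac [] = 0"
| "cfrac [a] = a"
| "cfrac (a # b # bs) = a + 1 / cfrac (b # bs)"

text \<open>Both algorithms are given by their runs: an inductive predicate for the runs that stop,
  with the finite list of partial quotients, and a coinductive one for the runs that never stop,
  with the infinite stream of partial quotients.\<close>

inductive usual_cf_fin :: "real \<Rightarrow> int list \<Rightarrow> bool" where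
  stop: "x - of_int \<lfloor>x\<rfloor> = 0 \<Longrightarrow> usual_cf_fin x [\<lfloor>x\<rfloor>]"
| step: "x - of_int \<lfloor>x\<rfloor> \<noteq> 0 \<Longrightarrow> usual_cf_fin (1 / (x - of_int \<lfloor>x\<rfloor>)) as
         \<Longrightarrow> usual_cf_fin x (\<lfloor>x\<rfloor> # as)"

coinductive usual_cf_inf :: "real \<Rightarrow> int stream \<Rightarrow> bool" where
  "x - of_int \<lfloor>x\<rfloor> \<noteq> 0 \<Longrightarrow> usual_cf_inf (1 / (x - of_int \<lfloor>x\<rfloor>)) s
   \<Longrightarrow> usual_cf_inf x (\<lfloor>x\<rfloor> ## s)"

definition fund_dom :: "complex set" where
  "fund_dom = {z. Im z > 0 \<and> - 1 / 2 \<le> Re z \<and> Re z < 1 / 2 \<and> cmod z \<ge> 1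
                 \<and> (cmod z = 1 \<longrightarrow> Re z \<le> 0)}"

definition S_act :: "complex \<Rightarrow> complex" where
  "S_act z = - 1 / z"

definition fund_dom' :: "complex set" where
  "fund_dom' = fund_dom \<union> S_act ` fund_dom \<union> {0} \<union> uminus ` (fund_dom \<union> S_act ` fund_dom)"

definition can_stop :: "complex \<Rightarrow> int \<Rightarrow> bool" where
  "can_stop z \<delta> \<longleftrightarrow> \<delta> \<in> {0, 1} \<and> z - of_int \<lfloor>Re z\<rfloor> - of_int \<delta> \<in> fund_dom'"

text \<open>Both values of \<open>\<delta>\<close> are admissible at the integer translates of \<open>exp (\<plusminus> \<i> \<pi> / 3)\<close>;
  the algorithm does not say which one to take there, so \<open>gcf_fin\<close> allows either.
  The last argument of \<open>gcf_fin\<close> is the final \<open>z\<^sub>0\<close>.\<close>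

inductive gcf_fin :: "complex \<Rightarrow> int list \<Rightarrow> complex \<Rightarrow> bool" where
  stop: "can_stop z \<delta> \<Longrightarrow> gcf_fin z [\<lfloor>Re z\<rfloor> + \<delta>] (z - of_int \<lfloor>Re z\<rfloor> - of_int \<delta>)"
| step: "(\<nexists>\<delta>. can_stop z \<delta>) \<Longrightarrow> gcf_fin (1 / (z - of_int \<lfloor>Re z\<rfloor>)) as z0
         \<Longrightarrow> gcf_fin z (\<lfloor>Re z\<rfloor> # as) z0"

coinductive gcf_inf :: "complex \<Rightarrow> int stream \<Rightarrow> bool" where
  "(\<nexists>\<delta>. can_stop z \<delta>) \<Longrightarrow> gcf_inf (1 / (z - of_int \<lfloor>Re z\<rfloor>)) s
   \<Longrightarrow> gcf_inf z (\<lfloor>Re z\<rfloor> ## s)"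

end

theory Submission
  imports Defs
begin

text \<open>Let \<open>w = z - \<lfloor>Re z\<rfloor>\<close> for non-real \<open>z\<close>. The algorithm can only fail to stop at \<open>z\<close> if \<open>w\<close> lies
  in the lens \<open>\<bar>w\<bar> \<le> 1\<close>, \<open>\<bar>w - 1\<bar> \<le> 1\<close>, so that \<open>Re (1 / w) \<ge> 1 / 2\<close>; if moreover \<open>Re (1 / w) < 1\<close>,
  then the algorithm stops at \<open>1 / w\<close> with \<open>\<delta> = 1\<close>. This makes all later partial quotients positive.
  If the algorithm stops neither at \<open>z\<close> nor at \<open>1 / w\<close>, then \<open>Re (1 / w) \<ge> 1\<close>, which gives
  \<open>\<bar>w\<bar>\<^sup>2 \<le> Re w \<le> 1 - (Im w)\<^sup>2\<close>, and \<open>\<bar>Im (1 / w)\<bar> = \<bar>Im w\<bar> / \<bar>w\<bar>\<^sup>2\<close> exceeds \<open>\<bar>Im z\<bar>\<close> at least by the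
  factor \<open>1 / (1 - (Im z)\<^sup>2)\<close>. As imaginary parts in the lens are bounded, this cannot go on forever.\<close>

abbreviation stops :: "complex \<Rightarrow> bool" where
  "stops z \<equiv> \<exists>\<delta>. can_stop z \<delta>"

definition gcf_next :: "complex \<Rightarrow> complex" where
  "gcf_next z = 1 / (z - of_int \<lfloor>Re z\<rfloor>)"

section \<open>Membership in \<open>fund_dom'\<close> as real inequalities\<close>

lemma fund_dom_iff:
  "z \<in> fund_dom \<longleftrightarrow> Im z > 0 \<and> - 1 / 2 \<le> Re z \<and> Re z < 1 / 2 \<and> (cmod z)\<^sup>2 \<ge> 1
     \<and> ((cmod z)\<^sup>2 = 1 \<longrightarrow> Re z \<le> 0)"
  by (auto simp: fund_dom_def abs_square_eq_1 one_le_power power2_eq_1_iff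
      dest: power2_le_imp_le[of 1 "cmod z", simplified])

lemma S_act_in_fund_dom_iff:
  "S_act z \<in> fund_dom \<longleftrightarrow> Im z > 0 \<and> (cmod z)\<^sup>2 \<le> 1 \<and> 2 * Re z \<le> (cmod z)\<^sup>2
     \<and> - 2 * Re z < (cmod z)\<^sup>2 \<and> ((cmod z)\<^sup>2 = 1 \<longrightarrow> Re z \<ge> 0)"
proof (cases "z = 0")
  case True
  \<comment> \<open>Division by zero gives \<open>S_act 0 = 0\<close>, so both sides fail at the
    condition on the imaginary part.\<close>
  then show ?thesis by (simp add: fund_dom_iff S_act_def)
next
  case False
  define n where "n = (cmod z)\<^sup>2"
  have n: "n > 0" using False by (simp add: n_def)
  have re: "Re (S_act z) = - Re z / n" and im: "Im (S_act z) = Im z / n"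
    by (simp_all add: S_act_def n_def Re_divide Im_divide cmod_power2)
  have nS: "(cmod (S_act z))\<^sup>2 = 1 / n"
    by (simp add: S_act_def n_def norm_divide power_divide)
  show ?thesis
    unfolding fund_dom_iff re im nS n_def[symmetric] using n by (auto simp: field_simps)
qed

text \<open>\<open>S_act\<close> (also at 0) and negation are involutions, so images turn into
  preimages.\<close>

lemma fund_dom'_iff:
  "z \<in> fund_dom' \<longleftrightarrow> z = 0 \<or> z \<in> fund_dom \<or> S_act z \<in> fund_dom
     \<or> - z \<in> fund_dom \<or> S_act (- z) \<in> fund_dom"
proof -
  have "S_act (S_act w) = w" for w by (simp add: S_act_def)
  then have "w \<in> S_act ` A \<longleftrightarrow> S_act w \<in> A" for w A by (metis image_iff)
  moreover have "w \<in> uminus ` A \<longleftrightarrow> - w \<in> A" for w :: complex and A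
    by (metis imageE imageI minus_minus)
  ultimately show ?thesis unfolding fund_dom'_def by simp
qed

text \<open>The sign of \<open>Im z\<close> leaves only two of the five pieces of the union.\<close>

lemma fund_dom'_upper_iff:
  assumes "Im z > 0"
  shows "z \<in> fund_dom' \<longleftrightarrow>
    (- 1 / 2 \<le> Re z \<and> Re z < 1 / 2 \<and> 1 \<le> (cmod z)\<^sup>2 \<and> ((cmod z)\<^sup>2 = 1 \<longrightarrow> Re z \<le> 0)) \<or>
    ((cmod z)\<^sup>2 \<le> 1 \<and> 2 * Re z \<le> (cmod z)\<^sup>2 \<and> - 2 * Re z < (cmod z)\<^sup>2
       \<and> ((cmod z)\<^sup>2 = 1 \<longrightarrow> Re z \<ge> 0))"
  unfolding fund_dom'_iff S_act_in_fund_dom_iff using assms by (auto simp: fund_dom_iff)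

lemma fund_dom'_lower_iff:
  assumes "Im z < 0"
  shows "z \<in> fund_dom' \<longleftrightarrow>
    (- 1 / 2 < Re z \<and> Re z \<le> 1 / 2 \<and> 1 \<le> (cmod z)\<^sup>2 \<and> ((cmod z)\<^sup>2 = 1 \<longrightarrow> Re z \<ge> 0)) \<or>
    ((cmod z)\<^sup>2 \<le> 1 \<and> - 2 * Re z \<le> (cmod z)\<^sup>2 \<and> 2 * Re z < (cmod z)\<^sup>2
       \<and> ((cmod z)\<^sup>2 = 1 \<longrightarrow> Re z \<le> 0))"
  unfolding fund_dom'_iff S_act_in_fund_dom_iff using assms by (auto simp: fund_dom_iff)

lemma fund_dom'_real:
  assumes "Im z = 0"
  shows "z \<in> fund_dom' \<longleftrightarrow> z = 0"
  unfolding fund_dom'_iff S_act_in_fund_dom_iff using assms by (auto simp: fund_dom_iff)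

text \<open>This makes the conditions on \<open>w - 1\<close>, like those on \<open>w\<close>,
  linear in \<open>Re w\<close> and \<open>(cmod w)\<^sup>2\<close>, so that \<open>argo\<close> can
  decide them.\<close>

lemma cmod_diff_one_squared: "(cmod (z - 1))\<^sup>2 = (cmod z)\<^sup>2 - 2 * Re z + 1"
  by (simp add: cmod_power2 power2_diff)

section \<open>Points where the algorithm does not stop, and their successors\<close>

lemma stops_iff:
  "stops z \<longleftrightarrow> z - of_int \<lfloor>Re z\<rfloor> \<in> fund_dom' \<or> z - of_int \<lfloor>Re z\<rfloor> - 1 \<in> fund_dom'"
  by (auto simp: can_stop_def)

text \<open>Of the strip outside the lens, the part with \<open>Re w < 1 / 2\<close> is covered by
  \<open>fund_dom\<close> and its image under \<open>S_act\<close>, the rest by their translates by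
  1. The second bound says \<open>cmod (w - 1) < 1\<close>.\<close>

lemma not_stops_upper:
  assumes "\<not> stops z" "Im z > 0"
  defines "w \<equiv> z - of_int \<lfloor>Re z\<rfloor>"
  shows "(cmod w)\<^sup>2 \<le> 1" "(cmod w)\<^sup>2 < 2 * Re w"
proof -
  have re: "0 \<le> Re w" "Re w < 1" and im: "Im w > 0" "Im (w - 1) > 0"
    using assms(2) by (simp_all add: w_def) linarith+
  have "w \<notin> fund_dom'" "w - 1 \<notin> fund_dom'"
    using assms(1) by (auto simp: stops_iff w_def)
  note this[unfolded im[THEN fund_dom'_upper_iff] cmod_diff_one_squared, simplified]
  \<comment> \<open>On the imaginary axis the strict condition in
    \<open>S_act w \<in> fund_dom\<close> reads exactly so.\<close>
  moreover have "(cmod w)\<^sup>2 > 0" using im by auto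
  ultimately show "(cmod w)\<^sup>2 \<le> 1" "(cmod w)\<^sup>2 < 2 * Re w" using re by argo+
qed

text \<open>Negation reverses the boundary conventions, so strict and weak bounds trade
  places.\<close>

lemma not_stops_lower:
  assumes "\<not> stops z" "Im z < 0"
  defines "w \<equiv> z - of_int \<lfloor>Re z\<rfloor>"
  shows "(cmod w)\<^sup>2 < 1" "(cmod w)\<^sup>2 \<le> 2 * Re w"
proof -
  have re: "0 \<le> Re w" "Re w < 1" and im: "Im w < 0" "Im (w - 1) < 0"
    using assms(2) by (simp_all add: w_def) linarith+
  have "w \<notin> fund_dom'" "w - 1 \<notin> fund_dom'"
    using assms(1) by (auto simp: stops_iff w_def)
  note this[unfolded im[THEN fund_dom'_lower_iff] cmod_diff_one_squared, simplified]
  moreover have "(cmod w)\<^sup>2 > 0" using im by auto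
  ultimately show "(cmod w)\<^sup>2 < 1" "(cmod w)\<^sup>2 \<le> 2 * Re w" using re by argo+
qed

text \<open>The lens after inversion, and the invariant of a run after its first step: the unit disc
  becomes its exterior, the disc around 1 the half plane \<open>Re z \<ge> 1 / 2\<close>. Inversion
  swaps the half planes, so the upper clause stems from \<open>not_stops_lower\<close> and vice
  versa.\<close>

definition outer :: "complex \<Rightarrow> bool" where
  "outer z \<longleftrightarrow> (Im z > 0 \<and> (cmod z)\<^sup>2 > 1 \<and> Re z \<ge> 1 / 2) \<or>
               (Im z < 0 \<and> (cmod z)\<^sup>2 \<ge> 1 \<and> Re z > 1 / 2)"

lemma gcf_next_parts:
  fixes z :: complex
  defines "w \<equiv> z - of_int \<lfloor>Re z\<rfloor>"
  shows "Re (gcf_next z) = Re w / (cmod w)\<^sup>2" "Im (gcf_next z) = - Im z / (cmod w)\<^sup>2"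
    "(cmod (gcf_next z))\<^sup>2 = 1 / (cmod w)\<^sup>2"
  by (simp_all add: gcf_next_def w_def Re_divide Im_divide cmod_power2 norm_divide power_divide)

lemma outer_gcf_next:
  assumes "\<not> stops z" "Im z \<noteq> 0"
  shows "outer (gcf_next z)"
proof -
  define w where "w = z - of_int \<lfloor>Re z\<rfloor>"
  have "w \<noteq> 0" using assms(2) by (auto simp: w_def complex_eq_iff)
  then have "(cmod w)\<^sup>2 > 0" by simp
  then show ?thesis
    using not_stops_upper[OF assms(1)] not_stops_lower[OF assms(1)] assms(2)
    unfolding outer_def gcf_next_parts w_def[symmetric]
    by (cases "Im z > 0") (auto simp: field_simps)
qed

text \<open>The strict bounds in \<open>outer\<close> exclude
  \<open>exp (\<plusminus> \<i> \<pi> / 3)\<close>, where \<delta> would be ambiguous.\<close>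

lemma outer_stops_at_one:
  assumes "outer z" "Re z < 1"
  shows "can_stop z \<delta> \<longleftrightarrow> \<delta> = 1"
proof -
  have floor: "\<lfloor>Re z\<rfloor> = 0"
    using assms by (auto simp: outer_def floor_eq_iff)
  have "z \<notin> fund_dom'" "z - 1 \<in> fund_dom'"
    using assms
    by (auto simp: outer_def fund_dom'_upper_iff fund_dom'_lower_iff cmod_diff_one_squared)
  then show ?thesis
    using floor by (auto simp: can_stop_def)
qed

section \<open>Partial quotients, value and remainder of a finite run\<close>

lemma gcf_fin_ge_1:
  assumes "gcf_fin z as z0" "outer z"
  shows "\<forall>a \<in> set as. a \<ge> 1"
  using assms
proof (induction rule: gcf_fin.induct)
  case (stop z \<delta>)
  have "\<delta> \<ge> 0" using stop(1) by (auto simp: can_stop_def)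
  show ?case
  proof (cases "Re z < 1")
    case True
    \<comment> \<open>Stopping with \<delta> = 0 would put out the quotient 0; \<open>outer\<close>
      rules this choice out.\<close>
    then have "\<delta> = 1" "\<lfloor>Re z\<rfloor> = 0"
      using stop outer_stops_at_one by (auto simp: outer_def floor_eq_iff)
    then show ?thesis by simp
  next
    case False
    then have "\<lfloor>Re z\<rfloor> \<ge> 1" by linarith
    then have "\<lfloor>Re z\<rfloor> + \<delta> \<ge> 1" using \<open>\<delta> \<ge> 0\<close> by linarith
    then show ?thesis by simp
  qed
next
  case (step z as z0)
  have "\<not> Re z < 1" using step.hyps(1) step.prems outer_stops_at_one by blast
  then have "\<lfloor>Re z\<rfloor> \<ge> 1" by linarith
  moreover have "outer (gcf_next z)"
    using step.hyps(1) step.prems by (intro outer_gcf_next) (auto simp: outer_def)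
  ultimately show ?case using step.IH by (simp add: gcf_next_def)
qed

text \<open>The head is exempt because the input itself need not be \<open>outer\<close>; its
  successor is.\<close>

lemma gcf_fin_tail_ge_1:
  assumes "gcf_fin z as z0" "Im z \<noteq> 0"
  shows "\<forall>a \<in> set (tl as). a \<ge> 1"
  using assms
proof cases
  case (step bs)
  then show ?thesis
    using gcf_fin_ge_1 outer_gcf_next[OF step(2) assms(2)] by (simp add: gcf_next_def)
qed simp

lemma cfrac_Cons:
  "xs \<noteq> [] \<Longrightarrow> cfrac (x # xs) = x + 1 / cfrac xs"
  by (cases xs) auto

lemma gcf_fin_value:
  assumes "gcf_fin z as z0"
  shows "as \<noteq> [] \<and> z = cfrac (map of_int (butlast as) @ [of_int (last as) + z0])"
  using assms
proof (induction rule: gcf_fin.induct)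
  case (step z as z0)
  then show ?case
    \<comment> \<open>With \<open>1 / 0 = 0\<close>, the identity \<open>1 / (1 / u) = u\<close>
      holds for every \<open>u\<close>.\<close>
    by (simp add: cfrac_Cons) (metis add_diff_cancel_left' add_diff_eq div_by_1 divide_divide_eq_right mult_1)
qed simp

lemma gcf_fin_remainder:
  assumes "gcf_fin z as z0" "Im z \<noteq> 0"
  shows "z0 \<in> fund_dom' - {0}"
  using assms
proof (induction rule: gcf_fin.induct)
  case (stop z \<delta>)
  then show ?case by (auto simp: can_stop_def complex_eq_iff)
next
  case (step z as z0)
  then have "Im (gcf_next z) \<noteq> 0" using outer_gcf_next[of z] by (auto simp: outer_def)
  then show ?case using step.IH by (simp add: gcf_next_def)
qed

section \<open>Termination for nonreal input\<close>

lemma gcf_next_Im_growth: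
  assumes "\<not> stops z" "\<not> stops (gcf_next z)" "Im z \<noteq> 0"
  shows "(Im z)\<^sup>2 < 1" "\<bar>Im (gcf_next z)\<bar> \<ge> \<bar>Im z\<bar> / (1 - (Im z)\<^sup>2)"
proof -
  define w where "w = z - of_int \<lfloor>Re z\<rfloor>"
  have im: "Im w = Im z" by (simp add: w_def)
  have "w \<noteq> 0" using assms(3) im by auto
  then have pos: "(cmod w)\<^sup>2 > 0" by simp
  have "Re (gcf_next z) \<ge> 1"
    using outer_gcf_next[OF assms(1,3)] outer_stops_at_one[of "gcf_next z"] assms(2)
    by (metis not_less)
  then have le: "(cmod w)\<^sup>2 \<le> Re w"
    using pos unfolding gcf_next_parts w_def[symmetric] by (simp add: field_simps)
  have x: "Re w \<ge> 0" "Re w < 1" by (simp_all add: w_def) linarith+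
  \<comment> \<open>The bound \<open>le\<close> describes the disc with diameter from 0 to
    1.\<close>
  have "(Im z)\<^sup>2 \<le> Re w * (1 - Re w)"
    using le unfolding cmod_power2 im by (simp add: power2_eq_square algebra_simps)
  also have "\<dots> \<le> 1 * (1 - Re w)"
    using x by (intro mult_right_mono) auto
  finally have bound: "(cmod w)\<^sup>2 \<le> 1 - (Im z)\<^sup>2" using le by simp
  then show lt1: "(Im z)\<^sup>2 < 1" using pos by linarith
  show "\<bar>Im (gcf_next z)\<bar> \<ge> \<bar>Im z\<bar> / (1 - (Im z)\<^sup>2)"
    unfolding gcf_next_parts w_def[symmetric] abs_divide abs_minus abs_power2
    using bound pos lt1 by (intro divide_left_mono) auto
qed

lemma gcf_fin_exists:
  assumes "Im z \<noteq> 0"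
  shows "\<exists>as z0. gcf_fin z as z0"
proof (rule ccontr)
  assume nofin: "\<nexists>as z0. gcf_fin z as z0"
  define f where "f n = (gcf_next ^^ n) z" for n
  have f_Suc: "f (Suc n) = gcf_next (f n)" for n by (simp add: f_def)
  \<comment> \<open>A finite run from some \<open>f n\<close> would extend backwards to a finite run
    from \<open>z\<close>.\<close>
  have nofin_f: "\<nexists>as z0. gcf_fin (f n) as z0" for n
  proof (induction n)
    case 0
    then show ?case using nofin by (simp add: f_def)
  next
    case (Suc n)
    then have "\<not> stops (f n)" using gcf_fin.stop by blast
    then show ?case
      using Suc gcf_fin.step[of "f n"] unfolding f_Suc gcf_next_def by blast
  qed
  then have run: "\<not> stops (f n)" for n using gcf_fin.stop by blast
  have nonreal: "Im (f n) \<noteq> 0" for n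
  proof (induction n)
    case 0
    then show ?case using assms by (simp add: f_def)
  next
    case (Suc n)
    then show ?case using outer_gcf_next[OF run, of n] by (auto simp: f_Suc outer_def)
  qed
  have lt1: "(Im (f n))\<^sup>2 < 1" for n
    using gcf_next_Im_growth(1)[OF run run[of "Suc n", unfolded f_Suc] nonreal] .
  have step: "\<bar>Im (f (Suc n))\<bar> \<ge> \<bar>Im (f n)\<bar> / (1 - (Im (f n))\<^sup>2)" for n
    unfolding f_Suc using gcf_next_Im_growth(2)[OF run run[of "Suc n", unfolded f_Suc] nonreal] .
  \<comment> \<open>The first growth factor serves for all steps: \<open>1 / (1 - y\<^sup>2)\<close>
    increases with \<open>\<bar>y\<bar> < 1\<close>, and no \<open>\<bar>Im (f n)\<bar>\<close>
    falls below \<open>\<bar>Im z\<bar>\<close>.\<close>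
  define r where "r = 1 / (1 - (Im z)\<^sup>2)"
  have "(Im z)\<^sup>2 < 1" using lt1[of 0] by (simp add: f_def)
  then have r: "r > 1" using assms by (simp add: r_def)
  have growth: "\<bar>Im (f n)\<bar> \<ge> r ^ n * \<bar>Im z\<bar>" for n
  proof (induction n)
    case 0
    then show ?case by (simp add: f_def)
  next
    case (Suc n)
    have "1 * \<bar>Im z\<bar> \<le> r ^ n * \<bar>Im z\<bar>"
      using r by (intro mult_right_mono) (auto simp: one_le_power)
    then have "\<bar>Im z\<bar> \<le> \<bar>Im (f n)\<bar>" using Suc by linarith
    then have "(Im z)\<^sup>2 \<le> (Im (f n))\<^sup>2" by (simp add: abs_le_square_iff)
    then have "r \<le> 1 / (1 - (Im (f n))\<^sup>2)"
      unfolding r_def using lt1[of n] by (intro divide_left_mono) auto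
    then have "r * (r ^ n * \<bar>Im z\<bar>) \<le> 1 / (1 - (Im (f n))\<^sup>2) * \<bar>Im (f n)\<bar>"
      using Suc r lt1[of n] by (intro mult_mono) auto
    then show ?case using step[of n] by simp
  qed
  obtain n where "1 / \<bar>Im z\<bar> < r ^ n" using real_arch_pow[OF r] by blast
  then have "1 < r ^ n * \<bar>Im z\<bar>" using assms by (simp add: field_simps)
  then have "1 < \<bar>Im (f n)\<bar>" using growth[of n] by linarith
  then show False using lt1[of n] by (simp add: abs_square_less_1)
qed

text \<open>Both kinds of run follow the same successors, but only a finite one ends at a stopping
  point.\<close>

lemma gcf_fin_not_inf:
  assumes "gcf_fin z as z0"
  shows "\<not> gcf_inf z s"
  using assms
proof (induction arbitrary: s rule: gcf_fin.induct)
  case (stop z \<delta>)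
  then show ?case using gcf_inf.cases by blast
next
  case (step z as z0)
  then show ?case using gcf_inf.cases by (metis (no_types))
qed

section \<open>Real input and the usual algorithm\<close>

lemma can_stop_of_real: "can_stop (of_real x) \<delta> \<longleftrightarrow> \<delta> = 0 \<and> x - of_int \<lfloor>x\<rfloor> = 0"
proof -
  \<comment> \<open>On the real axis \<open>fund_dom'\<close> is just \<open>{0}\<close>, and
    \<delta> = 1 would need a fractional part equal to 1.\<close>
  have "x - of_int \<lfloor>x\<rfloor> < 1" by linarith
  then show ?thesis
    by (auto simp: can_stop_def fund_dom'_real complex_eq_iff)
qed

lemma next_of_real:
  "1 / (complex_of_real x - of_int \<lfloor>Re (of_real x)\<rfloor>) = of_real (1 / (x - of_int \<lfloor>x\<rfloor>))"
  by simp

lemma gcf_fin_of_real_iff: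
  "(\<exists>z0. gcf_fin (of_real x) as z0) \<longleftrightarrow> usual_cf_fin x as"
proof
  have "usual_cf_fin x as" if "gcf_fin z as z0" "z = of_real x" for z z0
    using that
  proof (induction arbitrary: x rule: gcf_fin.induct)
    case (stop z \<delta>)
    then show ?case using usual_cf_fin.stop by (auto simp: can_stop_of_real)
  next
    case (step z as z0)
    then show ?case
      using usual_cf_fin.step[of x as] next_of_real[of x] by (auto simp: can_stop_of_real)
  qed
  then show "\<exists>z0. gcf_fin (of_real x) as z0 \<Longrightarrow> usual_cf_fin x as" by blast
next
  assume "usual_cf_fin x as"
  then show "\<exists>z0. gcf_fin (of_real x) as z0"
  proof (induction rule: usual_cf_fin.induct)
    case (stop x)
    then show ?case using gcf_fin.stop[of "of_real x" 0] by (auto simp: can_stop_of_real)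
  next
    case (step x as)
    then show ?case
      using gcf_fin.step[of "of_real x" as] next_of_real[of x] by (auto simp: can_stop_of_real)
  qed
qed

lemma gcf_inf_of_real_iff:
  "gcf_inf (of_real x) s \<longleftrightarrow> usual_cf_inf x s"
proof
  assume "gcf_inf (of_real x) s"
  then show "usual_cf_inf x s"
  proof (coinduction arbitrary: x s)
    case (usual_cf_inf x s)
    then show ?case
      by cases (use next_of_real[of x] in \<open>auto simp: can_stop_of_real\<close>)
  qed
next
  assume "usual_cf_inf x s"
  then show "gcf_inf (of_real x) s"
  proof (coinduction arbitrary: x s)
    case (gcf_inf x s)
    then show ?case
    proof cases
      case (1 t)
      have "\<not> stops (of_real x)" using 1(2) by (simp add: can_stop_of_real)
      then show ?thesis using 1 next_of_real[of x] by fastforce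
    qed
  qed
qed

lemma gcf_fin_or_inf: "(\<exists>as z0. gcf_fin z as z0) \<or> (\<exists>s. gcf_inf z s)"
proof (rule disjCI)
  assume nofin: "\<nexists>s. gcf_inf z s"
  show "\<exists>as z0. gcf_fin z as z0"
  proof (rule ccontr)
    assume "\<nexists>as z0. gcf_fin z as z0"
    \<comment> \<open>The witness lists the floors along the orbit; the coinduction invariant is the
      absence of a finite run.\<close>
    then have "gcf_inf z (smap (\<lambda>w. \<lfloor>Re w\<rfloor>) (siterate gcf_next z))"
    proof (coinduction arbitrary: z)
      case gcf_inf
      then have "\<not> stops z" using gcf_fin.stop by blast
      moreover from this have "\<nexists>as z0. gcf_fin (gcf_next z) as z0"
        using gcf_inf gcf_fin.step[of z] unfolding gcf_next_def by blast
      ultimately show ?case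
        by (auto simp: gcf_next_def siterate.code[of gcf_next z])
    qed
    with nofin show False by blast
  qed
qed

theorem theorem2p1:
  fixes z :: complex
  shows "(z \<in> \<real> \<longrightarrow>
            ((\<exists>as z0. gcf_fin z as z0) \<or> (\<exists>s. gcf_inf z s)) \<and>
            (\<forall>as. (\<exists>z0. gcf_fin z as z0) \<longleftrightarrow> usual_cf_fin (Re z) as) \<and>
            (\<forall>s. gcf_inf z s \<longleftrightarrow> usual_cf_inf (Re z) s)) \<and>
         (z \<notin> \<real> \<longrightarrow>
            (\<exists>as z0. gcf_fin z as z0) \<and>
            (\<nexists>s. gcf_inf z s) \<and>
            (\<forall>as z0. gcf_fin z as z0 \<longrightarrow>
               as \<noteq> [] \<and>
               z = cfrac (map of_int (butlast as) @ [of_int (last as) + z0]) \<and>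
               (\<forall>i. 1 \<le> i \<and> i < length as \<longrightarrow> as ! i \<ge> 1) \<and>
               z0 \<in> fund_dom' - {0}))"
proof (intro conjI impI)
  assume "z \<in> \<real>"
  then have z: "of_real (Re z) = z" by simp
  show "(\<exists>as z0. gcf_fin z as z0) \<or> (\<exists>s. gcf_inf z s)" by (rule gcf_fin_or_inf)
  show "\<forall>as. (\<exists>z0. gcf_fin z as z0) \<longleftrightarrow> usual_cf_fin (Re z) as"
    using gcf_fin_of_real_iff[of "Re z"] unfolding z by blast
  show "\<forall>s. gcf_inf z s \<longleftrightarrow> usual_cf_inf (Re z) s"
    using gcf_inf_of_real_iff[of "Re z"] unfolding z by blast
next
  assume "z \<notin> \<real>"
  then have im: "Im z \<noteq> 0" by (simp add: complex_is_Real_iff)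
  show fin: "\<exists>as z0. gcf_fin z as z0" by (rule gcf_fin_exists[OF im])
  then show "\<nexists>s. gcf_inf z s" using gcf_fin_not_inf by blast
  have "as ! i \<ge> 1" if "gcf_fin z as z0" "1 \<le> i" "i < length as" for as z0 i
  proof -
    have "as ! i = tl as ! (i - 1)" "i - 1 < length (tl as)"
      using that by (simp_all add: nth_tl)
    then show ?thesis using gcf_fin_tail_ge_1[OF that(1) im] by (metis nth_mem)
  qed
  then show "\<forall>as z0. gcf_fin z as z0 \<longrightarrow>
      as \<noteq> [] \<and>
      z = cfrac (map of_int (butlast as) @ [of_int (last as) + z0]) \<and>
      (\<forall>i. 1 \<le> i \<and> i < length as \<longrightarrow> as ! i \<ge> 1) \<and>
      z0 \<in> fund_dom' - {0}"
    using gcf_fin_value gcf_fin_remainder im by blast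
qed

end
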